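(* Let $\mathscr F$ be a free filter on $\omega$. The space $\omega_{\mathscr F}$ is $\mathbb R^{\omega_1}$-factorizable if and only if $\mathscr F$ is an $A$-filter. The space $\omega_{\mathscr F}$ is nonmetrizable if and only if the filter $\mathscr F$ has no countable base.
   Context: All topological spaces are assumed to be Tychonoff. A space $X$ is $\mathbb R^{\omega_1}$-factorizable if for every continuous function $f\colon X\to\mathbb R^{\omega_1}$ there exist a second-countable space $Y$ and continuous functions $h\colon X\to Y$ and $g\colon Y\to\mathbb R^{\omega_1}$ such that $f=g\circ h$. A filter $\mathscr F$ on a set is free if $\bigcap\mathscr F=\varnothing$. A filter $\mathscr F$ on a set is an $A$-filter if, given any $F_\alpha\in\mathscr F$, $\alpha<\omega_1$, there exist $G_n\in\mathscr F$, $n<\omega$, such that each $F_\alpha$ contains $G_{n_\alpha}$ for some $n_\alpha<\omega$. A base of $\mathscr F$ is a subfamily $\mathscr B\subset\mathscr F$ such that every element of $\mathscr F$ contains an element of $\mathscr B$. Given a free filter $\mathscr F$ on a set $X$, $X_{\mathscr F}$ denotes the space $X\cup\{\infty_X\}$, where $\infty_X\notin X$, in which all points of $X$ are isolated and $\mathscr F$ is the filter of punctured neighborhoods of $\infty_X$ (that is, the neighborhoods of $\infty_X$ are exactly the sets $F\cup\{\infty_X\}$ with $F\in\mathscr F$). *)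

theory Defs
  imports "HOL-Analysis.Analysis"
begin

definition tychonoff_space :: "'a topology \<Rightarrow> bool" where
  "tychonoff_space X \<longleftrightarrow> completely_regular_space X \<and> Hausdorff_space X"

text \<open>The least uncountable cardinal, as the carrier of the canonical well-order
  \<^term>\<open>cardSuc natLeq\<close>.\<close>

definition omega1 :: "nat set set" where
  "omega1 = Field (cardSuc natLeq)"

definition R_omega1 :: "(nat set \<Rightarrow> real) topology" where
  "R_omega1 = product_topology (\<lambda>_. euclideanreal) omega1"

definition factors_through ::
  "'a topology \<Rightarrow> 'c topology \<Rightarrow> ('a \<Rightarrow> 'c) \<Rightarrow> 'b topology \<Rightarrow> bool" where
  "factors_through X Z f Y \<longleftrightarrow>
     (\<exists>h g. continuous_map X Y h \<and> continuous_map Y Z g \<and> (\<forall>x\<in>topspace X. f x = g (h x)))"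

text \<open>HOL cannot quantify over the type of the points of the intermediate space. A
  second-countable Tychonoff space has at most continuum many points, so letting it range over
  all topologies on sets of reals loses nothing; this is the lemma
  \<open>factors_through_universal\<close> below.\<close>

definition R_omega1_factorizable :: "'a topology \<Rightarrow> bool" where
  "R_omega1_factorizable X \<longleftrightarrow>
     (\<forall>f. continuous_map X R_omega1 f \<longrightarrow>
       (\<exists>Y :: real topology. tychonoff_space Y \<and> second_countable Y \<and>
          factors_through X R_omega1 f Y))"

definition filter_sets :: "'a filter \<Rightarrow> 'a set set" where
  "filter_sets F = {A. eventually (\<lambda>x. x \<in> A) F}"

text \<open>The improper filter \<^term>\<open>bot\<close> counts as free.\<close>

definition free_filter :: "'a filter \<Rightarrow> bool" where
  "free_filter F \<longleftrightarrow> \<Inter> (filter_sets F) = {}"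

definition A_filter :: "'a filter \<Rightarrow> bool" where
  "A_filter F \<longleftrightarrow>
     (\<forall>S. (\<forall>\<alpha>\<in>omega1. S \<alpha> \<in> filter_sets F) \<longrightarrow>
       (\<exists>G :: nat \<Rightarrow> 'a set. (\<forall>n. G n \<in> filter_sets F) \<and> (\<forall>\<alpha>\<in>omega1. \<exists>n. G n \<subseteq> S \<alpha>)))"

definition filter_base :: "'a filter \<Rightarrow> 'a set set \<Rightarrow> bool" where
  "filter_base F B \<longleftrightarrow> B \<subseteq> filter_sets F \<and> (\<forall>A\<in>filter_sets F. \<exists>C\<in>B. C \<subseteq> A)"

text \<open>The point at infinity is \<^term>\<open>None\<close>.\<close>

definition filter_space :: "'a filter \<Rightarrow> 'a option topology" where
  "filter_space F = topology (\<lambda>U. None \<in> U \<longrightarrow> {x. Some x \<in> U} \<in> filter_sets F)"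

lemma filter_sets_mono: "A \<in> filter_sets F \<Longrightarrow> A \<subseteq> C \<Longrightarrow> C \<in> filter_sets F"
  unfolding filter_sets_def mem_Collect_eq by (erule eventually_mono) blast

lemma filter_sets_Int: "A \<in> filter_sets F \<Longrightarrow> C \<in> filter_sets F \<Longrightarrow> A \<inter> C \<in> filter_sets F"
  by (simp add: filter_sets_def eventually_conj)

lemma openin_filter_space:
  "openin (filter_space F) U \<longleftrightarrow> (None \<in> U \<longrightarrow> {x. Some x \<in> U} \<in> filter_sets F)"
proof -
  have "istopology (\<lambda>U. None \<in> U \<longrightarrow> {x. Some x \<in> U} \<in> filter_sets F)"
    unfolding istopology_def
  proof (intro conjI allI impI)
    fix S T :: "'a option set"
    assume "None \<in> S \<longrightarrow> {x. Some x \<in> S} \<in> filter_sets F"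
      "None \<in> T \<longrightarrow> {x. Some x \<in> T} \<in> filter_sets F" "None \<in> S \<inter> T"
    then have "{x. Some x \<in> S} \<inter> {x. Some x \<in> T} \<in> filter_sets F"
      by (simp add: filter_sets_Int)
    then show "{x. Some x \<in> S \<inter> T} \<in> filter_sets F"
      by (rule filter_sets_mono) blast
  next
    fix K :: "'a option set set"
    assume K: "\<forall>S\<in>K. None \<in> S \<longrightarrow> {x. Some x \<in> S} \<in> filter_sets F" and "None \<in> \<Union>K"
    then obtain S where "S \<in> K" "{x. Some x \<in> S} \<in> filter_sets F"
      by blast
    then show "{x. Some x \<in> \<Union>K} \<in> filter_sets F"
      by (elim filter_sets_mono) blast
  qed
  then show ?thesis
    by (simp add: filter_space_def)
qed

lemma topspace_filter_space [simp]: "topspace (filter_space F) = UNIV"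
  using openin_subset[of "filter_space F" UNIV] by (auto simp: openin_filter_space filter_sets_def)

lemma isolated_filter_space: "openin (filter_space F) {Some x}"
  by (simp add: openin_filter_space)

lemma neighbourhoods_filter_space:
  "(\<exists>U. openin (filter_space F) U \<and> None \<in> U \<and> U \<subseteq> N) \<longleftrightarrow>
   (\<exists>A\<in>filter_sets F. N = insert None (Some ` A))"
proof
  assume "\<exists>U. openin (filter_space F) U \<and> None \<in> U \<and> U \<subseteq> N"
  then obtain U where U: "{x. Some x \<in> U} \<in> filter_sets F" "None \<in> U" "U \<subseteq> N"
    by (auto simp: openin_filter_space)
  then have "{x. Some x \<in> N} \<in> filter_sets F"
    by (elim filter_sets_mono) blast
  moreover have "N = insert None (Some ` {x. Some x \<in> N})"
  proof (intro set_eqI)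
    fix z show "z \<in> N \<longleftrightarrow> z \<in> insert None (Some ` {x. Some x \<in> N})"
      using U by (cases z) auto
  qed
  ultimately show "\<exists>A\<in>filter_sets F. N = insert None (Some ` A)"
    by blast
next
  assume "\<exists>A\<in>filter_sets F. N = insert None (Some ` A)"
  then obtain A where A: "A \<in> filter_sets F" "N = insert None (Some ` A)"
    by blast
  moreover have "{x. Some x \<in> insert None (Some ` A)} = A"
    by auto
  ultimately have "openin (filter_space F) N"
    by (simp add: openin_filter_space)
  then show "\<exists>U. openin (filter_space F) U \<and> None \<in> U \<and> U \<subseteq> N"
    using A(2) by (intro exI[of _ N]) simp
qed

lemma tychonoff_filter_space:
  assumes "free_filter F"
  shows "tychonoff_space (filter_space F)"
proof -
  have co_pt: "{x. x \<noteq> a} \<in> filter_sets F" for a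
  proof -
    obtain A where A: "A \<in> filter_sets F" "a \<notin> A"
      using assms unfolding free_filter_def by blast
    show ?thesis
      by (rule filter_sets_mono[OF A(1)]) (use A(2) in auto)
  qed
  have cl: "openin (filter_space F) (- {Some a})" for a
    using co_pt[of a] by (simp add: openin_filter_space)
  have "Hausdorff_space (filter_space F)"
    unfolding Hausdorff_space_def
  proof (intro allI impI)
    fix x y assume "x \<in> topspace (filter_space F) \<and> y \<in> topspace (filter_space F) \<and> x \<noteq> y"
    then have "x \<noteq> y" by simp
    then consider a where "x = Some a" | b where "y = Some b"
      by (cases x; cases y) auto
    then show "\<exists>U V. openin (filter_space F) U \<and> openin (filter_space F) V \<and>
                 x \<in> U \<and> y \<in> V \<and> disjnt U V"
    proof cases
      case 1
      then show ?thesis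
        using \<open>x \<noteq> y\<close> by (intro exI[of _ "{x}"] exI[of _ "- {x}"])
          (auto simp: cl isolated_filter_space disjnt_def)
    next
      case 2
      then show ?thesis
        using \<open>x \<noteq> y\<close> by (intro exI[of _ "- {y}"] exI[of _ "{y}"])
          (auto simp: cl isolated_filter_space disjnt_def)
    qed
  qed
  moreover have "completely_regular_space (filter_space F)"
    unfolding completely_regular_space_def
  proof (intro allI impI)
    fix S x assume S: "closedin (filter_space F) S \<and> x \<in> topspace (filter_space F) - S"
    then have oS: "openin (filter_space F) (- S)"
      by (simp add: closedin_def Compl_eq_Diff_UNIV)
    have "\<exists>U. openin (filter_space F) U \<and> openin (filter_space F) (- U) \<and> x \<in> U \<and> U \<inter> S = {}"
    proof (cases x)
      case None
      then show ?thesis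
        using oS S by (intro exI[of _ "- S"]) (auto simp: openin_filter_space)
    next
      case (Some a)
      then show ?thesis
        using S cl isolated_filter_space by (intro exI[of _ "{x}"]) auto
    qed
    then obtain U where U: "openin (filter_space F) U" "openin (filter_space F) (- U)"
        "x \<in> U" "U \<inter> S = {}"
      by blast
    let ?f = "\<lambda>z. if z \<in> U then 0 else 1 :: real"
    have "openin (filter_space F) {z. ?f z \<in> V}" for V
    proof -
      have "{z. ?f z \<in> V} \<in> {{}, U, - U, UNIV}"
        by (cases "0 \<in> V"; cases "1 \<in> V") auto
      moreover have "\<forall>T\<in>{{}, U, - U, UNIV}. openin (filter_space F) T"
        using U openin_topspace[of "filter_space F"] by simp
      ultimately show ?thesis
        by (rule bspec[rotated])
    qed
    then have "continuous_map (filter_space F) (top_of_set {0..1}) ?f"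
      by (auto simp: continuous_map_in_subtopology continuous_map_def)
    then show "\<exists>f. continuous_map (filter_space F) (top_of_set {0..1::real}) f \<and>
                 f x = 0 \<and> f ` S \<subseteq> {1}"
      using U(3,4) by (intro exI[of _ ?f] conjI) auto
  qed
  ultimately show ?thesis
    by (simp add: tychonoff_space_def)
qed

lemma second_countable_Hausdorff_lepoll_real:
  assumes "second_countable Y" "Hausdorff_space Y"
  shows "topspace Y \<lesssim> (UNIV :: real set)"
proof -
  from assms(1) obtain B where B: "countable B"
      "\<forall>U x. openin Y U \<and> x \<in> U \<longrightarrow> (\<exists>V\<in>B. x \<in> V \<and> V \<subseteq> U)"
    unfolding second_countable_def by (elim exE conjE)
  let ?j = "\<lambda>y. to_nat_on B ` {V \<in> B. y \<in> V}"
  have "inj_on ?j (topspace Y)"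
  proof (rule inj_onI, rule ccontr)
    fix x y assume xy: "x \<in> topspace Y" "y \<in> topspace Y" "?j x = ?j y" "x \<noteq> y"
    obtain U U' where U: "openin Y U" "x \<in> U" "y \<in> U'" "disjnt U U'"
      using assms(2)[unfolded Hausdorff_space_def, rule_format, of x y] xy by auto
    then have "y \<notin> U"
      by (auto simp: disjnt_def)
    obtain V where V: "V \<in> B" "x \<in> V" "V \<subseteq> U"
      using B(2)[rule_format, of U x] U by auto
    have "to_nat_on B V \<in> ?j x"
      using V by blast
    then have "to_nat_on B V \<in> ?j y"
      using xy(3) by simp
    then obtain V' where "V' \<in> B" "y \<in> V'" "to_nat_on B V' = to_nat_on B V"
      by auto
    then have "y \<in> V"
      using inj_onD[OF inj_on_to_nat_on[OF B(1)], of V' V] V(1) by simp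
    then show False
      using V(3) \<open>y \<notin> U\<close> by blast
  qed
  then have "topspace Y \<lesssim> (UNIV :: nat set set)"
    unfolding lepoll_def by (intro exI[of _ ?j]) simp
  then show ?thesis
    by (rule lepoll_trans[OF _ eqpoll_imp_lepoll[OF nat_sets_eqpoll_reals]])
qed

lemma factors_through_universal:
  fixes X :: "'a topology" and Y :: "'b topology" and Z :: "'c topology"
  assumes "tychonoff_space Y" "second_countable Y" "factors_through X Z f Y"
  shows "\<exists>W :: real topology. tychonoff_space W \<and> second_countable W \<and> factors_through X Z f W"
proof -
  obtain j :: "'b \<Rightarrow> real" where j: "inj_on j (topspace Y)"
    using second_countable_Hausdorff_lepoll_real[OF assms(2)] assms(1)
    unfolding tychonoff_space_def lepoll_def by blast
  define k where "k = inv_into (topspace Y) j"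
  define W where "W = pullback_topology (j ` topspace Y) k Y"
  have kj: "k (j y) = y" if "y \<in> topspace Y" for y
    using that j by (simp add: k_def)
  have tW: "topspace W = j ` topspace Y"
    using kj by (auto simp: W_def topspace_pullback_topology)
  have "continuous_map Y W j"
    unfolding continuous_map_def
  proof (intro conjI allI impI)
    show "j \<in> topspace Y \<rightarrow> topspace W"
      by (simp add: tW)
    fix U assume "openin W U"
    then obtain V where V: "openin Y V" "U = k -` V \<inter> j ` topspace Y"
      unfolding W_def openin_pullback_topology by blast
    have "j y \<in> U \<longleftrightarrow> y \<in> V" if "y \<in> topspace Y" for y
      using that V(2) kj[OF that] by auto
    then have "{y \<in> topspace Y. j y \<in> U} = V"
      using openin_subset[OF V(1)] by blast
    then show "openin Y {y \<in> topspace Y. j y \<in> U}"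
      using V by simp
  qed
  moreover have "continuous_map W Y k"
    unfolding continuous_map_def
  proof (intro conjI allI impI)
    show "k \<in> topspace W \<rightarrow> topspace Y"
      by (auto simp: tW kj)
    fix V assume "openin Y V"
    then show "openin W {w \<in> topspace W. k w \<in> V}"
      unfolding W_def openin_pullback_topology
      by (intro exI[of _ V]) (use tW in \<open>auto simp: W_def\<close>)
  qed
  ultimately have hom: "homeomorphic_maps Y W j k"
    using kj by (auto simp: homeomorphic_maps_def tW)
  then have hs: "Y homeomorphic_space W"
    unfolding homeomorphic_space_def by blast
  have "tychonoff_space W"
    using assms(1) homeomorphic_completely_regular_space[OF hs] homeomorphic_Hausdorff_space[OF hs]
    by (simp add: tychonoff_space_def)
  moreover have "second_countable W"
    using assms(2) homeomorphic_space_second_countability[OF hs] by simp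
  moreover have "factors_through X Z f W"
  proof -
    obtain h g where h: "continuous_map X Y h" and g: "continuous_map Y Z g"
        and f: "\<forall>x\<in>topspace X. f x = g (h x)"
      using assms(3) unfolding factors_through_def by blast
    have "continuous_map X W (j \<circ> h)" "continuous_map W Z (g \<circ> k)"
      using hom h g by (auto simp: homeomorphic_maps_def intro: continuous_map_compose)
    moreover have "\<forall>x\<in>topspace X. f x = (g \<circ> k) ((j \<circ> h) x)"
      using f kj h by (auto simp: continuous_map_def Pi_iff)
    ultimately show ?thesis
      unfolding factors_through_def by blast
  qed
  ultimately show ?thesis
    by blast
qed

end

theory Submission
  imports Defs
begin

text \<open>
  Everything is decided at the single non-isolated point \<^term>\<open>None\<close>, whose punctured
  neighbourhoods are the members of the filter.

  For factorizability, a continuous map into \<open>\<real>\<^sup>\<omega>\<^sub>1\<close> is a family of \<open>\<omega>\<^sub>1\<close> real functions, and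
  continuity of each of them at \<^term>\<open>None\<close> says that countably many sets, one for each tolerance
  \<open>1/(k+1)\<close>, belong to the filter (lemma \<open>continuous_map_filter_space_real\<close>). If the filter is an
  \<open>A\<close>-filter, then for each tolerance countably many members of the filter refine all
  \<open>\<omega>\<^sub>1\<close> sets; over all tolerances these are still countably many sets, and the coarser
  filter that they generate, together with the complements of points, has a countable base. The
  complements of points keep it free, so its space is Tychonoff, and on a countable set the space
  is second-countable. The map stays continuous for this coarser filter, so the identity gives
  the factorization. Conversely, a family of \<open>\<omega>\<^sub>1\<close> members of the filter is coded by the
  indicator functions of their complements. If this map factors through \<open>h\<close> into a
  second-countable space, the preimages under \<open>h\<close> of a countable neighbourhood base at
  \<open>h(\<infinity>)\<close> are the countably many sets required of an \<open>A\<close>-filter.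

  For metrizability, a countable base of the filter is a countable neighbourhood base at the
  point \<^term>\<open>None\<close>, which every metrizable space has. Conversely a decreasing base with empty
  intersection assigns to each point its depth in the base, and the reciprocals of the depths are
  the distances to \<^term>\<open>None\<close> in an ultrametric.
\<close>

section \<open>Filters with a countable base\<close>

text \<open>Finite intersections turn an arbitrary sequence of generators into a decreasing base.\<close>

definition generated_filter :: "(nat \<Rightarrow> 'a set) \<Rightarrow> 'a filter" where
  "generated_filter A = (INF n. principal (\<Inter>i\<le>n. A i))"

lemma filter_sets_generated_filter:
  "filter_sets (generated_filter A) = {S. \<exists>n. (\<Inter>i\<le>n. A i) \<subseteq> S}"
proof -
  have "eventually P (generated_filter A) \<longleftrightarrow> (\<exists>n. \<forall>x\<in>(\<Inter>i\<le>n. A i). P x)" for P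
    unfolding generated_filter_def
  proof (subst eventually_INF_base)
    fix a b :: nat
    show "\<exists>x\<in>UNIV. principal (\<Inter>i\<le>x. A i)
            \<le> inf (principal (\<Inter>i\<le>a. A i)) (principal (\<Inter>i\<le>b. A i))"
      by (rule bexI[of _ "max a b"]) auto
  qed (auto simp: eventually_principal)
  then show ?thesis
    by (simp add: filter_sets_def subset_eq)
qed

lemma generator_in_generated_filter: "A n \<in> filter_sets (generated_filter A)"
proof -
  have "(\<Inter>i\<le>n. A i) \<subseteq> A n"
    by blast
  then show ?thesis
    unfolding filter_sets_generated_filter by blast
qed

lemma filter_sets_generated_filter_subset:
  assumes "\<And>n. A n \<in> filter_sets F"
  shows "filter_sets (generated_filter A) \<subseteq> filter_sets F"
proof
  fix S assume "S \<in> filter_sets (generated_filter A)"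
  then obtain n where n: "(\<Inter>i\<le>n. A i) \<subseteq> S"
    by (auto simp: filter_sets_generated_filter)
  have "(\<Inter>i\<le>n. A i) \<in> filter_sets F"
    using assms by (induction n) (auto simp: atMost_Suc filter_sets_Int)
  then show "S \<in> filter_sets F"
    using n by (rule filter_sets_mono)
qed

lemma UNIV_in_filter_sets: "UNIV \<in> filter_sets F"
  by (simp add: filter_sets_def)

lemma free_filter_co_point:
  assumes "free_filter F"
  shows "- {a} \<in> filter_sets F"
proof -
  obtain A where "A \<in> filter_sets F" "a \<notin> A"
    using assms unfolding free_filter_def by blast
  then show ?thesis
    using filter_sets_mono[of A F "- {a}"] by auto
qed

lemma countable_filter_base_decreasing:
  assumes "countable B" "filter_base F B"
  obtains D :: "nat \<Rightarrow> 'a set"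
  where "decseq D" "\<And>n. D n \<in> filter_sets F"
    "\<And>A. A \<in> filter_sets F \<Longrightarrow> \<exists>n. D n \<subseteq> A"
proof -
  have "B \<noteq> {}"
    using assms(2) UNIV_in_filter_sets[of F] unfolding filter_base_def by blast
  then have B: "range (from_nat_into B) = B"
    using assms(1) by simp
  define D where "D = (\<lambda>n. \<Inter>i\<le>n. from_nat_into B i)"
  have gen: "from_nat_into B n \<in> filter_sets F" for n
    using assms(2) from_nat_into[OF \<open>B \<noteq> {}\<close>, of n] unfolding filter_base_def by blast
  show thesis
  proof
    show "decseq D"
      unfolding decseq_def D_def
    proof (intro allI impI)
      fix m n :: nat assume "m \<le> n"
      then show "(\<Inter>i\<le>n. from_nat_into B i) \<subseteq> (\<Inter>i\<le>m. from_nat_into B i)"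
        by (rule INF_superset_mono[OF iffD2[OF atMost_subset_iff]]) simp
    qed
    show "D n \<in> filter_sets F" for n
    proof -
      have "D n \<in> filter_sets (generated_filter (from_nat_into B))"
        unfolding filter_sets_generated_filter D_def by blast
      then show ?thesis
        using filter_sets_generated_filter_subset[of "from_nat_into B", OF gen] by blast
    qed
    show "\<exists>n. D n \<subseteq> A" if A: "A \<in> filter_sets F" for A
    proof -
      obtain C where C: "C \<in> B" "C \<subseteq> A"
        using assms(2) A unfolding filter_base_def by blast
      then obtain n where "C = from_nat_into B n"
        using B by blast
      then have "D n \<subseteq> C"
        unfolding D_def by blast
      then have "D n \<subseteq> A"
        using C(2) by (rule subset_trans)
      then show ?thesis ..
    qed
  qed
qed

section \<open>Factorization through second-countable spaces\<close>

lemma openin_filter_space_nbhd: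
  assumes "A \<in> filter_sets F"
  shows "openin (filter_space F) (insert None (Some ` A))"
proof -
  have "{x. Some x \<in> insert None (Some ` A)} = A"
    by auto
  then show ?thesis
    using assms by (simp add: openin_filter_space)
qed

lemma second_countable_filter_space:
  fixes A :: "nat \<Rightarrow> 'a::countable set"
  shows "second_countable (filter_space (generated_filter A))"
  unfolding second_countable_def
proof (intro exI conjI ballI allI impI)
  let ?N = "\<lambda>n. insert None (Some ` (\<Inter>i\<le>n. A i))"
  let ?B = "range ?N \<union> range (\<lambda>x. {Some x})"
  show "countable ?B"
    by simp
  have "(\<Inter>i\<le>n. A i) \<in> filter_sets (generated_filter A)" for n
    unfolding filter_sets_generated_filter by blast
  then have N: "openin (filter_space (generated_filter A)) (?N n)" for n
    by (rule openin_filter_space_nbhd)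
  show "openin (filter_space (generated_filter A)) V" if "V \<in> ?B" for V
    using that by (elim UnE rangeE) (simp_all only: N isolated_filter_space)
  show "\<exists>V\<in>?B. x \<in> V \<and> V \<subseteq> U"
    if U: "openin (filter_space (generated_filter A)) U \<and> x \<in> U" for U x
  proof (cases x)
    case None
    then obtain n where "(\<Inter>i\<le>n. A i) \<subseteq> {x. Some x \<in> U}"
      using U by (auto simp: openin_filter_space filter_sets_generated_filter)
    then have "None \<in> ?N n" "?N n \<subseteq> U"
      using U None by auto
    then show ?thesis
      using None by blast
  next
    case (Some a)
    then show ?thesis
      using U by (intro bexI[of _ "{Some a}"]) auto
  qed
qed

text \<open>Tolerances \<open>1/(k+1)\<close> are enough, so a real function imposes only countably many conditions
  on the filter.\<close>

lemma continuous_map_filter_space_real: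
  fixes \<phi> :: "'a option \<Rightarrow> real"
  shows "continuous_map (filter_space F) euclideanreal \<phi> \<longleftrightarrow>
    (\<forall>k. {x. \<bar>\<phi> (Some x) - \<phi> None\<bar> < 1 / real (Suc k)} \<in> filter_sets F)"
    (is "?L \<longleftrightarrow> ?R")
proof
  assume L: ?L
  show ?R
  proof
    fix k
    have "openin (filter_space F) {z \<in> topspace (filter_space F).
            \<phi> z \<in> {\<phi> None - 1 / real (Suc k) <..< \<phi> None + 1 / real (Suc k)}}"
      by (rule openin_continuous_map_preimage[OF L]) simp
    then have "{x. \<phi> (Some x) \<in> {\<phi> None - 1 / real (Suc k) <..< \<phi> None + 1 / real (Suc k)}}
        \<in> filter_sets F"
      by (simp add: openin_filter_space del: of_nat_Suc)
    then show "{x. \<bar>\<phi> (Some x) - \<phi> None\<bar> < 1 / real (Suc k)} \<in> filter_sets F"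
      by (rule filter_sets_mono) (auto simp del: of_nat_Suc)
  qed
next
  assume R: ?R
  show ?L
    unfolding continuous_map_def
  proof (intro conjI allI impI)
    fix U :: "real set" assume "openin euclideanreal U"
    then have U: "open U"
      by simp
    have "{x. \<phi> (Some x) \<in> U} \<in> filter_sets F" if "\<phi> None \<in> U"
    proof -
      obtain e where e: "e > 0" "ball (\<phi> None) e \<subseteq> U"
        using U \<open>\<phi> None \<in> U\<close> open_contains_ball by blast
      obtain k where k: "1 / real (Suc k) < e"
        using nat_approx_posE[OF e(1)] .
      show ?thesis
      proof (rule filter_sets_mono[OF R[rule_format, of k]])
        show "{x. \<bar>\<phi> (Some x) - \<phi> None\<bar> < 1 / real (Suc k)} \<subseteq> {x. \<phi> (Some x) \<in> U}"
        proof clarify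
          fix x assume "\<bar>\<phi> (Some x) - \<phi> None\<bar> < 1 / real (Suc k)"
          then have "\<phi> (Some x) \<in> ball (\<phi> None) e"
            using k by (simp add: dist_real_def abs_minus_commute del: of_nat_Suc)
          then show "\<phi> (Some x) \<in> U"
            using e(2) by blast
        qed
      qed
    qed
    then show "openin (filter_space F) {z \<in> topspace (filter_space F). \<phi> z \<in> U}"
      by (simp add: openin_filter_space)
  qed simp
qed

lemma A_filter_imp_factorizable:
  fixes F :: "'a::countable filter"
  assumes "free_filter F" "A_filter F"
  shows "R_omega1_factorizable (filter_space F)"
  unfolding R_omega1_factorizable_def
proof (intro allI impI)
  fix f assume f: "continuous_map (filter_space F) R_omega1 f"
  then have ext: "range f \<subseteq> extensional omega1"
    and comp: "\<And>\<alpha>. \<alpha> \<in> omega1 \<Longrightarrow> continuous_map (filter_space F) euclideanreal (\<lambda>z. f z \<alpha>)"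
    unfolding R_omega1_def continuous_map_componentwise by auto
  define S where "S k \<alpha> = {x. \<bar>f (Some x) \<alpha> - f None \<alpha>\<bar> < 1 / real (Suc k)}" for k \<alpha>
  \<comment> \<open>One application for each tolerance avoids indexing by pairs from \<open>\<omega>\<^sub>1 \<times> \<omega>\<close>.\<close>
  have "\<exists>G :: nat \<Rightarrow> 'a set. (\<forall>n. G n \<in> filter_sets F) \<and> (\<forall>\<alpha>\<in>omega1. \<exists>n. G n \<subseteq> S k \<alpha>)" for k
  proof (rule assms(2)[unfolded A_filter_def, THEN spec, THEN mp])
    show "\<forall>\<alpha>\<in>omega1. S k \<alpha> \<in> filter_sets F"
      using comp unfolding S_def continuous_map_filter_space_real by blast
  qed
  then obtain G :: "nat \<Rightarrow> nat \<Rightarrow> 'a set" where G: "\<And>k n. G k n \<in> filter_sets F"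
      and refine: "\<And>k \<alpha>. \<alpha> \<in> omega1 \<Longrightarrow> \<exists>n. G k n \<subseteq> S k \<alpha>"
    by metis
  define B where "B = range (\<lambda>(k, n). G k n) \<union> range (\<lambda>a. - {a})"
  have B: "countable B" "B \<noteq> {}" "B \<subseteq> filter_sets F"
    using G free_filter_co_point[OF assms(1)] by (auto simp: B_def)
  define E where "E = generated_filter (from_nat_into B)"
  have in_E: "C \<in> filter_sets E" if "C \<in> B" for C
    using from_nat_into_surj[OF B(1) that] generator_in_generated_filter[of "from_nat_into B"]
    unfolding E_def by metis
  have E_le: "filter_sets E \<subseteq> filter_sets F"
    unfolding E_def
    by (rule filter_sets_generated_filter_subset, rule subsetD[OF B(3)], rule from_nat_into[OF B(2)])
  have "\<Inter> (filter_sets E) \<subseteq> (\<Inter>a. - {a})"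
    using in_E by (auto simp: B_def)
  then have "free_filter E"
    unfolding free_filter_def by auto
  then have "tychonoff_space (filter_space E)"
    by (rule tychonoff_filter_space)
  moreover have "second_countable (filter_space E)"
    unfolding E_def by (rule second_countable_filter_space)
  moreover have "factors_through (filter_space F) R_omega1 f (filter_space E)"
    unfolding factors_through_def
  proof (intro exI conjI ballI)
    show "continuous_map (filter_space F) (filter_space E) (\<lambda>z. z)"
      using E_le by (auto simp: continuous_map_def openin_filter_space)
    have "S k \<alpha> \<in> filter_sets E" if \<alpha>: "\<alpha> \<in> omega1" for k \<alpha>
    proof -
      obtain n where "G k n \<subseteq> S k \<alpha>"
        using refine[OF \<alpha>] by blast
      moreover have "G k n \<in> filter_sets E"
        by (rule in_E) (auto simp: B_def)
      ultimately show ?thesis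
        by (metis filter_sets_mono)
    qed
    then show "continuous_map (filter_space E) R_omega1 f"
      using ext unfolding R_omega1_def continuous_map_componentwise
        continuous_map_filter_space_real S_def by auto
  qed simp
  ultimately show "\<exists>Y :: real topology. tychonoff_space Y \<and> second_countable Y \<and>
      factors_through (filter_space F) R_omega1 f Y"
    by (rule factors_through_universal)
qed

lemma factorizable_imp_A_filter:
  assumes "R_omega1_factorizable (filter_space F)"
  shows "A_filter F"
  unfolding A_filter_def
proof (intro allI impI)
  fix S :: "nat set \<Rightarrow> 'a set" assume S: "\<forall>\<alpha>\<in>omega1. S \<alpha> \<in> filter_sets F"
  define \<phi> :: "nat set \<Rightarrow> 'a option \<Rightarrow> real"
    where "\<phi> \<alpha> z = (if z \<in> insert None (Some ` S \<alpha>) then 0 else 1)" for \<alpha> z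
  define f where "f z = (\<lambda>\<alpha>\<in>omega1. \<phi> \<alpha> z)" for z
  have "continuous_map (filter_space F) euclideanreal (\<phi> \<alpha>)" if "\<alpha> \<in> omega1" for \<alpha>
    unfolding continuous_map_filter_space_real
  proof
    fix k
    show "{x. \<bar>\<phi> \<alpha> (Some x) - \<phi> \<alpha> None\<bar> < 1 / real (Suc k)} \<in> filter_sets F"
      by (rule filter_sets_mono[OF S[rule_format, OF that]]) (auto simp: \<phi>_def)
  qed
  then have "continuous_map (filter_space F) R_omega1 f"
    unfolding R_omega1_def continuous_map_componentwise by (auto simp: f_def)
  then obtain Y :: "real topology" and h g where Y: "second_countable Y"
    and h: "continuous_map (filter_space F) Y h" and g: "continuous_map Y R_omega1 g"
    and fgh: "\<And>z. f z = g (h z)"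
    using assms unfolding R_omega1_factorizable_def factors_through_def by auto
  have hY: "h None \<in> topspace Y"
    using h by (auto simp: continuous_map_def Pi_iff)
  then obtain B where B: "countable B" "\<And>V. V \<in> B \<Longrightarrow> openin Y V"
    "\<And>U. openin Y U \<Longrightarrow> h None \<in> U \<Longrightarrow> \<exists>V\<in>B. h None \<in> V \<and> V \<subseteq> U"
    using second_countable_imp_first_countable[OF Y] unfolding first_countable_def by metis
  define C where "C = {V \<in> B. h None \<in> V}"
  define G where "G n = {x. h (Some x) \<in> from_nat_into C n}" for n
  have C: "countable C"
    using B(1) by (simp add: C_def)
  have "C \<noteq> {}"
    using B(3)[OF openin_topspace hY] by (auto simp: C_def)
  have "G n \<in> filter_sets F" for n
  proof -
    have V: "from_nat_into C n \<in> C"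
      using \<open>C \<noteq> {}\<close> by (rule from_nat_into)
    then have "openin (filter_space F) {z \<in> topspace (filter_space F). h z \<in> from_nat_into C n}"
      using B(2) by (intro openin_continuous_map_preimage[OF h]) (simp add: C_def)
    then show ?thesis
      using V by (simp add: openin_filter_space G_def C_def)
  qed
  moreover have "\<exists>n. G n \<subseteq> S \<alpha>" if \<alpha>: "\<alpha> \<in> omega1" for \<alpha>
  proof -
    have "continuous_map Y euclideanreal (\<lambda>y. g y \<alpha>)"
      using g \<alpha> unfolding R_omega1_def continuous_map_componentwise by blast
    then have "openin Y {y \<in> topspace Y. g y \<alpha> \<in> {..<1}}"
      by (rule openin_continuous_map_preimage) simp
    moreover have val: "g (h z) \<alpha> = \<phi> \<alpha> z" for z
      using fgh[of z] \<alpha> by (metis f_def restrict_apply)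
    ultimately obtain V where V: "V \<in> B" "h None \<in> V" "V \<subseteq> {y \<in> topspace Y. g y \<alpha> \<in> {..<1}}"
      using B(3)[of "{y \<in> topspace Y. g y \<alpha> \<in> {..<1}}"] hY by (auto simp: \<phi>_def)
    then have "V \<in> C"
      by (simp add: C_def)
    then obtain n where n: "from_nat_into C n = V"
      using from_nat_into_surj[OF C] by metis
    have "x \<in> S \<alpha>" if "x \<in> G n" for x
    proof -
      have "\<phi> \<alpha> (Some x) < 1"
        using that V(3) n val[of "Some x"] by (auto simp: G_def)
      then show ?thesis
        by (auto simp: \<phi>_def split: if_splits)
    qed
    then show ?thesis
      by blast
  qed
  ultimately show "\<exists>G :: nat \<Rightarrow> 'a set. (\<forall>n. G n \<in> filter_sets F) \<and>
      (\<forall>\<alpha>\<in>omega1. \<exists>n. G n \<subseteq> S \<alpha>)"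
    by blast
qed

section \<open>Metrizability\<close>

lemma metrizable_imp_countable_filter_base:
  assumes "metrizable_space (filter_space F)"
  shows "\<exists>B. countable B \<and> filter_base F B"
proof -
  obtain C where C: "countable C" "\<And>V. V \<in> C \<Longrightarrow> openin (filter_space F) V"
    "\<And>U. openin (filter_space F) U \<Longrightarrow> None \<in> U \<Longrightarrow> \<exists>V\<in>C. None \<in> V \<and> V \<subseteq> U"
    using metrizable_imp_first_countable[OF assms] unfolding first_countable_def
    by (metis UNIV_I topspace_filter_space)
  let ?B = "(\<lambda>V. {x. Some x \<in> V}) ` {V \<in> C. None \<in> V}"
  have "countable ?B"
    using C(1) by simp
  moreover have "filter_base F ?B"
    unfolding filter_base_def
  proof (intro conjI ballI)
    show "?B \<subseteq> filter_sets F"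
      using C(2) by (auto simp: openin_filter_space)
    fix A assume "A \<in> filter_sets F"
    then obtain V where "V \<in> C" "None \<in> V" "V \<subseteq> insert None (Some ` A)"
      using C(3)[OF openin_filter_space_nbhd] by blast
    then show "\<exists>D\<in>?B. D \<subseteq> A"
      by (intro bexI[of _ "{x. Some x \<in> V}"]) auto
  qed
  ultimately show ?thesis
    by blast
qed

text \<open>The radius of a point is its distance from the point at infinity. The distance of two
  distinct points is the larger of their radii, so the ball about a point of positive radius
  \<open>\<rho>\<close> with radius \<open>\<rho>\<close> is a singleton, and the balls about the point at infinity are the sets of
  all points of small radius.\<close>

lemma metrizable_filter_space_radius:
  fixes \<rho> :: "'a option \<Rightarrow> real"
  assumes radius_None: "\<rho> None = 0" and pos: "\<And>x. \<rho> (Some x) > 0"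
    and small: "\<And>e. e > 0 \<Longrightarrow> {x. \<rho> (Some x) < e} \<in> filter_sets F"
    and base: "\<And>A. A \<in> filter_sets F \<Longrightarrow> \<exists>e>0. {x. \<rho> (Some x) < e} \<subseteq> A"
  shows "metrizable_space (filter_space F)"
proof -
  define d where "d a b = (if a = b then 0 else max (\<rho> a) (\<rho> b))" for a b
  have nonneg: "\<rho> a \<ge> 0" for a
    using radius_None pos by (cases a) (auto intro: less_imp_le)
  have only: "\<rho> a = 0 \<longleftrightarrow> a = None" for a
    using radius_None pos[of "the a"] by (cases a) auto
  interpret Metric_space UNIV d
  proof
    show "0 \<le> d a b" for a b
      using nonneg[of a] by (auto simp: d_def)
    show "d a b = d b a" for a b
      by (simp add: d_def max.commute)
    show "d a b = 0 \<longleftrightarrow> a = b" for a b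
    proof -
      have "a = b" if "max (\<rho> a) (\<rho> b) = 0"
        using that nonneg[of a] nonneg[of b] only[of a] only[of b] by (auto simp: max_def split: if_splits)
      then show ?thesis
        by (auto simp: d_def)
    qed
    show "d a c \<le> d a b + d b c" for a b c
      using nonneg[of a] nonneg[of b] nonneg[of c] by (auto simp: d_def)
  qed
  have ball_None: "mball None e = insert None (Some ` {x. \<rho> (Some x) < e})" if "e > 0" for e
  proof (rule set_eqI)
    fix z show "z \<in> mball None e \<longleftrightarrow> z \<in> insert None (Some ` {x. \<rho> (Some x) < e})"
      using that by (cases z) (simp_all add: d_def radius_None image_iff)
  qed
  have ball_Some: "mball (Some x) (\<rho> (Some x)) = {Some x}" for x
    using pos[of x] by (auto simp: d_def split: if_splits)
  have "openin mtopology U \<longleftrightarrow> openin (filter_space F) U" for U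
  proof
    assume U: "openin mtopology U"
    show "openin (filter_space F) U"
      unfolding openin_filter_space
    proof
      assume "None \<in> U"
      then obtain e where e: "e > 0" "mball None e \<subseteq> U"
        using U unfolding openin_mtopology by blast
      then have "{x. \<rho> (Some x) < e} \<subseteq> {x. Some x \<in> U}"
        using ball_None by auto
      then show "{x. Some x \<in> U} \<in> filter_sets F"
        using small[OF e(1)] by (metis filter_sets_mono)
    qed
  next
    assume U: "openin (filter_space F) U"
    have "\<exists>e>0. mball z e \<subseteq> U" if z: "z \<in> U" for z
    proof (cases z)
      case None
      then obtain e where e: "e > 0" "{x. \<rho> (Some x) < e} \<subseteq> {x. Some x \<in> U}"
        using U z base unfolding openin_filter_space by blast
      then have "mball z e \<subseteq> U"
        unfolding None ball_None[OF e(1)] using z None by auto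
      then show ?thesis
        using e(1) by blast
    next
      case (Some x)
      then show ?thesis
        using z ball_Some[of x] pos[of x] by (intro exI[of _ "\<rho> z"]) simp
    qed
    then show "openin mtopology U"
      unfolding openin_mtopology by blast
  qed
  then have "mtopology = filter_space F"
    by (simp add: topology_eq)
  then show ?thesis
    using metrizable_space_mtopology by simp
qed

text \<open>Freeness makes every point leave the decreasing base after finitely many steps; the
  reciprocal of the first stage that misses a point serves as its radius.\<close>

lemma countable_filter_base_imp_metrizable:
  assumes "free_filter F" "countable B" "filter_base F B"
  shows "metrizable_space (filter_space F)"
proof -
  obtain D where D: "decseq D" "\<And>n. D n \<in> filter_sets F"
    "\<And>A. A \<in> filter_sets F \<Longrightarrow> \<exists>n. D n \<subseteq> A"
    using countable_filter_base_decreasing[OF assms(2,3)] by metis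
  define N where "N x = (LEAST n. x \<notin> D n)" for x
  have leave: "x \<notin> D (N x)" for x
  proof -
    obtain n where "D n \<subseteq> - {x}"
      using D(3)[OF free_filter_co_point[OF assms(1)]] by blast
    then have "x \<notin> D n"
      by blast
    then show ?thesis
      unfolding N_def by (rule LeastI)
  qed
  have depth: "x \<in> D n \<longleftrightarrow> n < N x" for x n
    using leave[of x] not_less_Least[of n "\<lambda>n. x \<notin> D n"] decseqD[OF D(1), of "N x" n]
    unfolding N_def[symmetric] by (meson linorder_not_less subsetD)
  define \<rho> where "\<rho> z = (case z of None \<Rightarrow> 0 | Some x \<Rightarrow> 1 / real (Suc (N x)))" for z
  have level: "{x. \<rho> (Some x) < 1 / real (Suc n)} = D n" for n
    by (auto simp: \<rho>_def depth field_simps)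
  show ?thesis
  proof (rule metrizable_filter_space_radius)
    show "\<rho> None = 0" "\<And>x. \<rho> (Some x) > 0"
      by (simp_all add: \<rho>_def)
    show "{x. \<rho> (Some x) < e} \<in> filter_sets F" if e: "e > 0" for e
    proof -
      obtain n where "1 / real (Suc n) < e"
        using nat_approx_posE[OF e] .
      then have "D n \<subseteq> {x. \<rho> (Some x) < e}"
        unfolding level[symmetric] by auto
      then show ?thesis
        using D(2) by (metis filter_sets_mono)
    qed
    show "\<exists>e>0. {x. \<rho> (Some x) < e} \<subseteq> A" if A: "A \<in> filter_sets F" for A
    proof -
      obtain n where "D n \<subseteq> A"
        using D(3)[OF A] by blast
      then show ?thesis
        using level[of n] by (intro exI[of _ "1 / real (Suc n)"]) simp
    qed
  qed
qed

theorem mainTheorem2: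
  fixes F :: "nat filter"
  assumes "free_filter F"
  shows "(R_omega1_factorizable (filter_space F) \<longleftrightarrow> A_filter F) \<and>
         (\<not> metrizable_space (filter_space F) \<longleftrightarrow> \<not> (\<exists>B. countable B \<and> filter_base F B))"
  using assms A_filter_imp_factorizable factorizable_imp_A_filter
    metrizable_imp_countable_filter_base countable_filter_base_imp_metrizable by metis

end
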